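(* The proximal mapping of the function $F$ (defined in the context) with parameter $\gamma>0$ is $$\mathrm{Prox}_{F,\gamma}(\widehat\rho,\widehat{\mathbf{m}}):=\operatorname*{arg\,min}_{\rho,\mathbf{m}}\; F(\rho,\mathbf{m})+\frac{1}{2\gamma}\left((\rho-\widehat\rho)^2+\|\mathbf{m}-\widehat{\mathbf{m}}\|^2\right)=\begin{cases}(0,\mathbf{0}), & \text{if } \widehat\rho\le 0,\ \|\widehat{\mathbf{m}}\|^2\le -2\gamma\widehat\rho,\\[4pt] \left(\overline\rho,\ \dfrac{\widehat{\mathbf{m}}\,\overline\rho}{\overline\rho+\gamma}\right), & \text{otherwise}.\end{cases}$$ Here $\overline\rho$ is the unique real-number solution of the cubic equation $$\overline\rho^{3}+(2\gamma-\widehat\rho)\,\overline\rho^{2}+(\gamma^2-2\gamma\widehat\rho)\,\overline\rho-\tfrac12\gamma\|\widehat{\mathbf{m}}\|^2-\gamma^2\widehat\rho=0.$$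
   Context: $D$ is the spatial dimension and $\|\cdot\|$ denotes the Euclidean norm. The dynamic optimal transport cost function $F$, with density variable $b\ge 0$ and flux variable $\mathbf{a}\in\mathbb{R}^D$, takes values in $\mathbb{R}\cup\{\infty\}$ and is defined by $F(b,\mathbf{a})=\frac{\|\mathbf{a}\|^2}{2b}$ if $b>0$; $F(b,\mathbf{a})=0$ if $b=0$ and $\mathbf{a}=\mathbf{0}$; and $F(b,\mathbf{a})=+\infty$ if $b=0$ and $\mathbf{a}\neq\mathbf{0}$. The point $(\widehat\rho,\widehat{\mathbf{m}})$, with $\widehat\rho\in\mathbb{R}$ and $\widehat{\mathbf{m}}\in\mathbb{R}^D$, is the argument of the proximal mapping; the minimization variables $(\rho,\mathbf{m})$ range over the domain on which $F$ is defined.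
   Formalization: The cubic can have several real roots in the "otherwise" case (γ=1, ρ̂=−7, ‖m̂‖=8 gives 1 and −5), so ρ̄ is taken to be the unique nonnegative real root; its existence and uniqueness among nonnegative reals are proved in that case. *)

theory Defs
  imports "HOL-Analysis.Analysis"
begin

text \<open>
  The cost is only meaningful for \<open>b \<ge> 0\<close>. HOL functions are total, so negative densities get
  the value \<open>\<infinity>\<close> as well, but the minimisation in \<open>Prox\<close> excludes them explicitly and never
  uses that value.
\<close>

definition F :: "real \<Rightarrow> real ^ 'd \<Rightarrow> ereal" where
  "F b a =
    (if b > 0 then ereal ((norm a)\<^sup>2 / (2 * b))
     else if b = 0 \<and> a = 0 then 0
     else \<infinity>)"

definition prox_objective ::
    "real \<Rightarrow> real \<Rightarrow> real ^ 'd \<Rightarrow> real \<times> (real ^ 'd) \<Rightarrow> ereal" where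
  "prox_objective \<gamma> \<rho>h mh =
    (\<lambda>(\<rho>, m). F \<rho> m + ereal (1 / (2 * \<gamma>) * ((\<rho> - \<rho>h)\<^sup>2 + (norm (m - mh))\<^sup>2)))"

text \<open>
  The arg min is the set of all minimisers over \<open>{\<rho> \<ge> 0} \<times> \<real>\<^sup>D\<close>; that the proximal mapping takes
  a value \<open>p\<close> is expressed as this set being the singleton \<open>{p}\<close>.
\<close>

definition Prox :: "real \<Rightarrow> real \<Rightarrow> real ^ 'd \<Rightarrow> (real \<times> (real ^ 'd)) set" where
  "Prox \<gamma> \<rho>h mh = {p. is_arg_min (prox_objective \<gamma> \<rho>h mh) (\<lambda>(\<rho>, m). \<rho> \<ge> 0) p}"

text \<open>
  This is \<open>(\<rho> + \<gamma>)\<^sup>2 (\<rho> - \<rho>h) = \<gamma> \<parallel>mh\<parallel>\<^sup>2 / 2\<close> expanded. The solution meant is the unique real one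
  that is an admissible density, \<open>\<rho> \<ge> 0\<close>: in the case where it is used the cubic can have further,
  negative, real roots. For \<open>mh = 0\<close> and \<open>\<rho>h > 0\<close> the roots are \<open>\<rho>h\<close> and \<open>-\<gamma>\<close>; for \<open>\<gamma> = 1\<close>,
  \<open>\<rho>h = -7\<close>, \<open>\<parallel>mh\<parallel> = 8\<close> they are \<open>1\<close> and \<open>-5\<close>.
\<close>

definition prox_cubic :: "real \<Rightarrow> real \<Rightarrow> real ^ 'd \<Rightarrow> real \<Rightarrow> bool" where
  "prox_cubic \<gamma> \<rho>h mh \<rho> \<longleftrightarrow>
    \<rho> ^ 3 + (2 * \<gamma> - \<rho>h) * \<rho>\<^sup>2 + (\<gamma>\<^sup>2 - 2 * \<gamma> * \<rho>h) * \<rho>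
      - 1 / 2 * \<gamma> * (norm mh)\<^sup>2 - \<gamma>\<^sup>2 * \<rho>h = 0"

end

theory Submission
  imports Defs
begin

text \<open>
  The cost is the support function of a paraboloid: for \<open>\<rho> \<ge> 0\<close>, \<open>F \<rho> m\<close> is the supremum over
  \<open>v\<close> of the linear functions \<open>m \<bullet> v - \<rho> \<parallel>v\<parallel>\<^sup>2 / 2\<close>, and it is attained when \<open>m = \<rho> v\<close>. So a
  velocity \<open>v\<close> provides an affine minorant of \<open>F\<close> that touches it at \<open>(\<rho>\<^sub>0, \<rho>\<^sub>0 v)\<close>
  (\<open>F_ge_linear\<close>, \<open>F_velocity\<close>). Replacing \<open>F\<close> by the minorant turns the proximal objective into
  a quadratic whose Hessian is \<open>1 / \<gamma>\<close> times the identity; its minimum over \<open>\<rho> \<ge> 0\<close> is read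
  off from the first-order conditions. If these hold at the touching point, then that point minimises the original
  objective as well, uniquely by strong convexity (\<open>Prox_eqI\<close>). The conditions are
  \<open>(\<rho>\<^sub>0 + \<gamma>) v = mh\<close> and \<open>\<rho>\<^sub>0 - \<rho>h \<ge> \<gamma> \<parallel>v\<parallel>\<^sup>2 / 2\<close>, with equality if \<open>\<rho>\<^sub>0 > 0\<close>.

  For \<open>\<rho>\<^sub>0 = 0\<close> they say \<open>v = mh / \<gamma>\<close> and \<open>\<parallel>mh\<parallel>\<^sup>2 \<le> - 2 \<gamma> \<rho>h\<close>, which is the first case of the
  theorem. For \<open>\<rho>\<^sub>0 > 0\<close> eliminating \<open>v = mh / (\<rho>\<^sub>0 + \<gamma>)\<close> from the equality gives
  \<open>(\<rho>\<^sub>0 + \<gamma>)\<^sup>2 (\<rho>\<^sub>0 - \<rho>h) = \<gamma> \<parallel>mh\<parallel>\<^sup>2 / 2\<close>, which is the cubic. It has exactly one nonnegative root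
  in the second case: its left side minus its right side is negative at \<open>0\<close>, tends to infinity,
  and at a nonnegative root \<open>\<rho> \<ge> \<rho>h\<close>, beyond which the left side is strictly increasing.
\<close>

section \<open>Affine minorants of the cost\<close>

lemma norm_diff_scaleR_squared:
  fixes x v :: "'a::real_inner"
  shows "(norm (x - c *\<^sub>R v))\<^sup>2 = (norm x)\<^sup>2 - 2 * c * (x \<bullet> v) + c\<^sup>2 * (norm v)\<^sup>2"
  unfolding power2_norm_eq_inner
  by (simp add: inner_diff_left inner_diff_right inner_commute[of v x]
      power2_eq_square algebra_simps)

text \<open>
  After multiplication by \<open>2 \<rho>\<close> the inequality is \<open>0 \<le> \<parallel>m - \<rho> v\<parallel>\<^sup>2\<close>.
\<close>

lemma F_ge_linear:
  fixes m v :: "real ^ 'd"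
  assumes "\<rho> \<ge> 0"
  shows "ereal (m \<bullet> v - \<rho> * (norm v)\<^sup>2 / 2) \<le> F \<rho> m"
proof (cases "\<rho> > 0")
  case True
  have "0 \<le> (norm (m - \<rho> *\<^sub>R v))\<^sup>2" by simp
  also have "\<dots> = (norm m)\<^sup>2 - 2 * \<rho> * (m \<bullet> v) + \<rho>\<^sup>2 * (norm v)\<^sup>2"
    by (rule norm_diff_scaleR_squared)
  finally have "m \<bullet> v - \<rho> * (norm v)\<^sup>2 / 2 \<le> (norm m)\<^sup>2 / (2 * \<rho>)"
    using True by (simp add: field_simps power2_eq_square)
  then show ?thesis using True by (simp add: F_def)
qed (use assms in \<open>auto simp: F_def zero_ereal_def\<close>)

lemma F_velocity:
  fixes v :: "real ^ 'd"
  assumes "\<rho> \<ge> 0"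
  shows "F \<rho> (\<rho> *\<^sub>R v) = ereal (\<rho> * (norm v)\<^sup>2 / 2)"
  using assms by (auto simp: F_def zero_ereal_def power2_eq_square field_simps)

section \<open>First-order conditions for the proximal mapping\<close>

text \<open>
  The quadratic growth comes from the penalty alone: the expansion of the two squares around
  \<open>(\<rho>\<^sub>0, \<rho>\<^sub>0 v)\<close> has a linear part that cancels the minorant of \<open>F\<close> in \<open>m\<close>, and in \<open>\<rho>\<close> leaves
  \<open>(\<rho> - \<rho>\<^sub>0) s / \<gamma> = \<rho> s / \<gamma> \<ge> 0\<close> with the slack \<open>s = \<rho>\<^sub>0 - \<rho>h - \<gamma> \<parallel>v\<parallel>\<^sup>2 / 2\<close>.
\<close>

lemma prox_objective_growth:
  fixes m mh v :: "real ^ 'd"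
  assumes \<gamma>: "\<gamma> > 0" and \<rho>0: "\<rho>\<^sub>0 \<ge> 0"
    and flux: "\<rho>\<^sub>0 *\<^sub>R v = mh - \<gamma> *\<^sub>R v"
    and slack: "\<gamma> * (norm v)\<^sup>2 / 2 \<le> \<rho>\<^sub>0 - \<rho>h"
    and compl: "\<rho>\<^sub>0 * (\<rho>\<^sub>0 - \<rho>h - \<gamma> * (norm v)\<^sup>2 / 2) = 0"
    and \<rho>: "\<rho> \<ge> 0"
  shows "prox_objective \<gamma> \<rho>h mh (\<rho>\<^sub>0, \<rho>\<^sub>0 *\<^sub>R v)
           + ereal (((\<rho> - \<rho>\<^sub>0)\<^sup>2 + (norm (m - \<rho>\<^sub>0 *\<^sub>R v))\<^sup>2) / (2 * \<gamma>))
         \<le> prox_objective \<gamma> \<rho>h mh (\<rho>, m)"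
proof -
  define s where "s = \<rho>\<^sub>0 - \<rho>h - \<gamma> * (norm v)\<^sup>2 / 2"
  have s: "0 \<le> \<rho> * s" "\<rho>\<^sub>0 * s = 0"
    using slack compl \<rho> by (auto simp: s_def)
  have mh: "mh = (\<rho>\<^sub>0 + \<gamma>) *\<^sub>R v" using flux by (simp add: algebra_simps)
  have "\<rho>\<^sub>0 *\<^sub>R v - mh = - \<gamma> *\<^sub>R v" by (simp add: mh algebra_simps)
  then have norm0: "(norm (\<rho>\<^sub>0 *\<^sub>R v - mh))\<^sup>2 = \<gamma>\<^sup>2 * (norm v)\<^sup>2"
    by (simp add: power_mult_distrib)
  have split: "m - mh = (m - \<rho>\<^sub>0 *\<^sub>R v) - \<gamma> *\<^sub>R v" by (simp add: mh algebra_simps)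
  have norm1: "(norm (m - mh))\<^sup>2
      = (norm (m - \<rho>\<^sub>0 *\<^sub>R v))\<^sup>2 - 2 * \<gamma> * (m \<bullet> v - \<rho>\<^sub>0 * (norm v)\<^sup>2) + \<gamma>\<^sup>2 * (norm v)\<^sup>2"
    unfolding split norm_diff_scaleR_squared[of "m - \<rho>\<^sub>0 *\<^sub>R v"]
    by (simp add: inner_diff_left dot_square_norm)
  have dens: "(\<rho> - \<rho>h)\<^sup>2
      = (\<rho> - \<rho>\<^sub>0)\<^sup>2 + (\<rho>\<^sub>0 - \<rho>h)\<^sup>2 + (\<rho> - \<rho>\<^sub>0) * (2 * s + \<gamma> * (norm v)\<^sup>2)"
    by (simp add: s_def power2_eq_square algebra_simps)
  have "\<rho>\<^sub>0 * (norm v)\<^sup>2 / 2 + 1 / (2 * \<gamma>) * ((\<rho>\<^sub>0 - \<rho>h)\<^sup>2 + (norm (\<rho>\<^sub>0 *\<^sub>R v - mh))\<^sup>2)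
          + ((\<rho> - \<rho>\<^sub>0)\<^sup>2 + (norm (m - \<rho>\<^sub>0 *\<^sub>R v))\<^sup>2) / (2 * \<gamma>)
      = m \<bullet> v - \<rho> * (norm v)\<^sup>2 / 2 + 1 / (2 * \<gamma>) * ((\<rho> - \<rho>h)\<^sup>2 + (norm (m - mh))\<^sup>2)
          - (\<rho> - \<rho>\<^sub>0) * s / \<gamma>"
    unfolding norm0 norm1 dens using \<gamma> by (simp add: field_simps)
  also have "\<dots> \<le> m \<bullet> v - \<rho> * (norm v)\<^sup>2 / 2
      + 1 / (2 * \<gamma>) * ((\<rho> - \<rho>h)\<^sup>2 + (norm (m - mh))\<^sup>2)"
    using s \<gamma> by (auto simp: left_diff_distrib)
  finally have "prox_objective \<gamma> \<rho>h mh (\<rho>\<^sub>0, \<rho>\<^sub>0 *\<^sub>R v)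
           + ereal (((\<rho> - \<rho>\<^sub>0)\<^sup>2 + (norm (m - \<rho>\<^sub>0 *\<^sub>R v))\<^sup>2) / (2 * \<gamma>))
      \<le> ereal (m \<bullet> v - \<rho> * (norm v)\<^sup>2 / 2)
          + ereal (1 / (2 * \<gamma>) * ((\<rho> - \<rho>h)\<^sup>2 + (norm (m - mh))\<^sup>2))"
    by (simp add: prox_objective_def F_velocity[OF \<rho>0])
  also have "\<dots> \<le> prox_objective \<gamma> \<rho>h mh (\<rho>, m)"
    unfolding prox_objective_def prod.case by (intro add_right_mono F_ge_linear \<rho>)
  finally show ?thesis .
qed

lemma Prox_eqI:
  fixes mh v :: "real ^ 'd"
  assumes \<gamma>: "\<gamma> > 0" and \<rho>0: "\<rho>\<^sub>0 \<ge> 0"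
    and flux: "\<rho>\<^sub>0 *\<^sub>R v = mh - \<gamma> *\<^sub>R v"
    and slack: "\<gamma> * (norm v)\<^sup>2 / 2 \<le> \<rho>\<^sub>0 - \<rho>h"
    and compl: "\<rho>\<^sub>0 * (\<rho>\<^sub>0 - \<rho>h - \<gamma> * (norm v)\<^sup>2 / 2) = 0"
  shows "Prox \<gamma> \<rho>h mh = {(\<rho>\<^sub>0, \<rho>\<^sub>0 *\<^sub>R v)}"
proof -
  let ?J = "prox_objective \<gamma> \<rho>h mh"
  have finite0: "\<exists>c. ?J (\<rho>\<^sub>0, \<rho>\<^sub>0 *\<^sub>R v) = ereal c"
    by (simp add: prox_objective_def F_velocity[OF \<rho>0])
  have strict: "?J (\<rho>\<^sub>0, \<rho>\<^sub>0 *\<^sub>R v) < ?J (\<rho>, m)"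
    if "\<rho> \<ge> 0" and ne: "(\<rho>, m) \<noteq> (\<rho>\<^sub>0, \<rho>\<^sub>0 *\<^sub>R v)" for \<rho> m
  proof -
    have "0 < (\<rho> - \<rho>\<^sub>0)\<^sup>2 + (norm (m - \<rho>\<^sub>0 *\<^sub>R v))\<^sup>2"
      using ne by (auto simp: add_pos_nonneg add_nonneg_pos)
    then have "0 < ((\<rho> - \<rho>\<^sub>0)\<^sup>2 + (norm (m - \<rho>\<^sub>0 *\<^sub>R v))\<^sup>2) / (2 * \<gamma>)"
      using \<gamma> by simp
    then have "?J (\<rho>\<^sub>0, \<rho>\<^sub>0 *\<^sub>R v) < ?J (\<rho>\<^sub>0, \<rho>\<^sub>0 *\<^sub>R v)
        + ereal (((\<rho> - \<rho>\<^sub>0)\<^sup>2 + (norm (m - \<rho>\<^sub>0 *\<^sub>R v))\<^sup>2) / (2 * \<gamma>))"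
      using finite0 by auto
    also have "\<dots> \<le> ?J (\<rho>, m)"
      using prox_objective_growth[OF assms that(1)] .
    finally show ?thesis .
  qed
  have "is_arg_min ?J (\<lambda>(\<rho>, m). \<rho> \<ge> 0) (\<rho>, m) \<longleftrightarrow> (\<rho>, m) = (\<rho>\<^sub>0, \<rho>\<^sub>0 *\<^sub>R v)" for \<rho> m
  proof
    assume "is_arg_min ?J (\<lambda>(\<rho>, m). \<rho> \<ge> 0) (\<rho>, m)"
    then show "(\<rho>, m) = (\<rho>\<^sub>0, \<rho>\<^sub>0 *\<^sub>R v)"
      using strict[of \<rho> m] \<rho>0 by (auto simp: is_arg_min_def)
  next
    assume eq: "(\<rho>, m) = (\<rho>\<^sub>0, \<rho>\<^sub>0 *\<^sub>R v)"
    have "\<not> ?J (\<rho>', m') < ?J (\<rho>\<^sub>0, \<rho>\<^sub>0 *\<^sub>R v)" if "\<rho>' \<ge> 0" for \<rho>' m'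
      using strict[OF that, of m'] by (metis less_asym)
    then show "is_arg_min ?J (\<lambda>(\<rho>, m). \<rho> \<ge> 0) (\<rho>, m)"
      using \<rho>0 eq by (auto simp: is_arg_min_def)
  qed
  then show ?thesis by (auto simp: Prox_def)
qed

section \<open>The cubic equation\<close>

lemma prox_cubic_iff_factored:
  "prox_cubic \<gamma> \<rho>h mh \<rho> \<longleftrightarrow> (\<rho> + \<gamma>)\<^sup>2 * (\<rho> - \<rho>h) = \<gamma> * (norm mh)\<^sup>2 / 2"
proof -
  have "\<rho> ^ 3 + (2 * \<gamma> - \<rho>h) * \<rho>\<^sup>2 + (\<gamma>\<^sup>2 - 2 * \<gamma> * \<rho>h) * \<rho>
      - 1 / 2 * \<gamma> * (norm mh)\<^sup>2 - \<gamma>\<^sup>2 * \<rho>h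
      = (\<rho> + \<gamma>)\<^sup>2 * (\<rho> - \<rho>h) - \<gamma> * (norm mh)\<^sup>2 / 2"
    by (simp add: power2_eq_square power3_eq_cube algebra_simps)
  then show ?thesis unfolding prox_cubic_def by (simp only: right_minus_eq)
qed

lemma factored_cubic_strict_mono:
  fixes a b \<gamma> \<rho>h :: real
  assumes "\<gamma> > 0" "0 \<le> a" "\<rho>h \<le> a" "a < b"
  shows "(a + \<gamma>)\<^sup>2 * (a - \<rho>h) < (b + \<gamma>)\<^sup>2 * (b - \<rho>h)"
proof -
  have "(a + \<gamma>)\<^sup>2 * (a - \<rho>h) \<le> (b + \<gamma>)\<^sup>2 * (a - \<rho>h)"
    using assms by (intro mult_right_mono power_mono) auto
  also have "\<dots> < (b + \<gamma>)\<^sup>2 * (b - \<rho>h)"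
    using assms by (intro mult_strict_left_mono) auto
  finally show ?thesis .
qed

lemma prox_cubic_root_ge:
  assumes "\<gamma> > 0" "\<rho> \<ge> 0" "prox_cubic \<gamma> \<rho>h mh \<rho>"
  shows "\<rho>h \<le> \<rho>"
proof -
  have "(\<rho> + \<gamma>)\<^sup>2 * (\<rho> - \<rho>h) = \<gamma> * (norm mh)\<^sup>2 / 2"
    using assms by (simp only: prox_cubic_iff_factored)
  also have "\<dots> \<ge> 0" using assms by simp
  finally have "0 \<le> (\<rho> + \<gamma>)\<^sup>2 * (\<rho> - \<rho>h)" .
  then show ?thesis
    using assms by (simp add: zero_le_mult_iff)
qed

lemma prox_cubic_root_unique:
  assumes \<gamma>: "\<gamma> > 0"
    and a: "a \<ge> 0" "prox_cubic \<gamma> \<rho>h mh a" and b: "b \<ge> 0" "prox_cubic \<gamma> \<rho>h mh b"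
  shows "a = b"
  using factored_cubic_strict_mono[OF \<gamma> a(1) prox_cubic_root_ge[OF \<gamma> a], of b]
    factored_cubic_strict_mono[OF \<gamma> b(1) prox_cubic_root_ge[OF \<gamma> b], of a] a b
  by (cases a b rule: linorder_cases) (auto simp: prox_cubic_iff_factored)

lemma prox_cubic_root_exists:
  fixes mh :: "real ^ 'd"
  assumes \<gamma>: "\<gamma> > 0" and pos: "(norm mh)\<^sup>2 + 2 * \<gamma> * \<rho>h > 0"
  shows "\<exists>\<rho> > 0. prox_cubic \<gamma> \<rho>h mh \<rho>"
proof -
  define c where "c = \<gamma> * (norm mh)\<^sup>2 / 2"
  let ?g = "\<lambda>\<rho>. (\<rho> + \<gamma>)\<^sup>2 * (\<rho> - \<rho>h)"
  have "c \<ge> 0" using \<gamma> by (simp add: c_def)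
  have "0 < \<gamma> / 2 * ((norm mh)\<^sup>2 + 2 * \<gamma> * \<rho>h)" using \<gamma> pos by simp
  then have g0: "?g 0 < c"
    by (simp add: c_def power2_eq_square algebra_simps)
  \<comment> \<open>At \<open>B\<close> the linear factor is at least \<open>c / \<gamma>\<^sup>2\<close> and the squared one at least \<open>\<gamma>\<^sup>2\<close>.\<close>
  define B where "B = \<bar>\<rho>h\<bar> + c / \<gamma>\<^sup>2"
  have "B \<ge> 0" using \<open>c \<ge> 0\<close> by (simp add: B_def)
  have "c = \<gamma>\<^sup>2 * (c / \<gamma>\<^sup>2)" using \<gamma> by simp
  also have "\<dots> \<le> ?g B"
    using \<open>c \<ge> 0\<close> \<open>B \<ge> 0\<close> \<gamma>
    by (intro mult_mono power_mono) (auto simp: B_def)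
  finally have gB: "c \<le> ?g B" .
  have "\<exists>x\<ge>0. x \<le> B \<and> ?g x = c"
    using g0 gB \<open>B \<ge> 0\<close> by (intro IVT') (auto intro!: continuous_intros)
  then obtain x where x: "x \<ge> 0" "?g x = c" by blast
  have "x \<noteq> 0" using x g0 by auto
  then show ?thesis
    using x by (auto simp: prox_cubic_iff_factored c_def intro!: exI[of _ x])
qed

section \<open>The proximal mapping\<close>

theorem lemma2p1:
  fixes \<gamma> \<rho>h :: real and mh :: "real ^ 'd"
  assumes "\<gamma> > 0"
  shows "if \<rho>h \<le> 0 \<and> (norm mh)\<^sup>2 \<le> - 2 * \<gamma> * \<rho>h
         then Prox \<gamma> \<rho>h mh = {(0, 0)}
         else (\<exists>!\<rho>. \<rho> \<ge> 0 \<and> prox_cubic \<gamma> \<rho>h mh \<rho>) \<and>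
              (\<forall>\<rho>. \<rho> \<ge> 0 \<and> prox_cubic \<gamma> \<rho>h mh \<rho> \<longrightarrow>
                   Prox \<gamma> \<rho>h mh = {(\<rho>, (\<rho> / (\<rho> + \<gamma>)) *\<^sub>R mh)})"
proof (cases "\<rho>h \<le> 0 \<and> (norm mh)\<^sup>2 \<le> - 2 * \<gamma> * \<rho>h")
  case True
  have "\<gamma> * (norm ((1 / \<gamma>) *\<^sub>R mh))\<^sup>2 / 2 = (norm mh)\<^sup>2 / (2 * \<gamma>)"
    using assms by (simp add: power_divide power2_eq_square)
  also have "\<dots> \<le> - \<rho>h"
    using True assms by (simp add: field_simps)
  finally have "Prox \<gamma> \<rho>h mh = {(0, 0 *\<^sub>R ((1 / \<gamma>) *\<^sub>R mh))}"
    using assms by (intro Prox_eqI) auto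
  then show ?thesis using True by simp
next
  case False
  have pos: "(norm mh)\<^sup>2 + 2 * \<gamma> * \<rho>h > 0"
  proof (cases "\<rho>h \<le> 0")
    case True
    then show ?thesis using False by auto
  next
    case False
    then show ?thesis using assms by (intro add_nonneg_pos) auto
  qed
  have "\<exists>!\<rho>. \<rho> \<ge> 0 \<and> prox_cubic \<gamma> \<rho>h mh \<rho>"
    using prox_cubic_root_exists[OF assms pos] prox_cubic_root_unique[OF assms, of _ \<rho>h mh]
    by (metis less_imp_le)
  moreover have "Prox \<gamma> \<rho>h mh = {(\<rho>, (\<rho> / (\<rho> + \<gamma>)) *\<^sub>R mh)}"
    if "\<rho> \<ge> 0" and root: "prox_cubic \<gamma> \<rho>h mh \<rho>" for \<rho>
  proof -
    define v where "v = (1 / (\<rho> + \<gamma>)) *\<^sub>R mh"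
    have mh: "mh = (\<rho> + \<gamma>) *\<^sub>R v" using that assms by (simp add: v_def)
    have "(\<rho> + \<gamma>)\<^sup>2 * (\<rho> - \<rho>h) = (\<rho> + \<gamma>)\<^sup>2 * (\<gamma> * (norm v)\<^sup>2 / 2)"
      using root by (simp add: prox_cubic_iff_factored mh power_mult_distrib)
    then have velocity: "\<rho> - \<rho>h = \<gamma> * (norm v)\<^sup>2 / 2" using that assms by simp
    have "Prox \<gamma> \<rho>h mh = {(\<rho>, \<rho> *\<^sub>R v)}"
      using that assms by (intro Prox_eqI) (simp_all only: velocity mh, auto simp: scaleR_left_distrib)
    then show ?thesis by (simp add: v_def)
  qed
  ultimately show ?thesis unfolding if_not_P[OF False] by blast
qed

end
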